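(* Let $s$ be a binary string of length $\ell\ge 2$ consisting only of $0$s. Then no vertex in any parallel chip-firing game on a strongly connected directed graph has $s$ as its atomic firing sequence.
   Context: A directed graph $D=(V,E)$ is a finite set of vertices $V$ with a set $E$ of ordered pairs of vertices; $(u,v)\in E$ is an edge directed from $u$ to $v$, and the out-degree $\deg^+ v$ is the number of edges directed from $v$. It is strongly connected if there is a directed path in both directions between every pair of vertices. A parallel chip-firing game on $D$ starts with a finite nonnegative integer number of chips on each vertex. In each round, simultaneously, every vertex $v$ having at least $\deg^+ v$ chips fires, sending one chip along each of its outgoing edges; all other vertices wait. The game has period $T$ if $T$ is the smallest positive integer for which there is a round $t_0$ such that every vertex has the same number of chips in round $t$ as in round $t+T$ for all $t\ge t_0$. The least such $t_0$ is relabelled round $0$. Let $F_t(v)=1$ if $v$ fires in round $t$ and $F_t(v)=0$ otherwise. The atomic firing sequence of $v$ is the length-$T$ binary string $F_0(v)F_1(v)\cdots F_{T-1}(v)$, where $T$ is the period of the game. *)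

theory Defs
  imports "Graph_Theory.Graph_Theory"
begin

(* The digraph is a pair_pre_digraph, i.e. a vertex set with a set of ordered pairs; loops are
   not excluded. A chip configuration is a function on the vertex type; its values
   outside pverts D play no role. *)

definition fires :: "'a pair_pre_digraph \<Rightarrow> ('a \<Rightarrow> nat) \<Rightarrow> 'a \<Rightarrow> bool" where
  "fires D c v \<longleftrightarrow> out_degree (with_proj D) v \<le> c v"

(* A firing vertex has at least out_degree many chips, so the subtraction on nat never truncates. *)
definition chip_step :: "'a pair_pre_digraph \<Rightarrow> ('a \<Rightarrow> nat) \<Rightarrow> 'a \<Rightarrow> nat" where
  "chip_step D c v =
     (if fires D c v then c v - out_degree (with_proj D) v else c v)
       + card {u \<in> pverts D. (u, v) \<in> parcs D \<and> fires D c u}"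

(* chips D c t v: number of chips on v in round t of the game started from c. *)
definition chips :: "'a pair_pre_digraph \<Rightarrow> ('a \<Rightarrow> nat) \<Rightarrow> nat \<Rightarrow> 'a \<Rightarrow> nat" where
  "chips D c t = (chip_step D ^^ t) c"

definition periodic_from :: "'a pair_pre_digraph \<Rightarrow> ('a \<Rightarrow> nat) \<Rightarrow> nat \<Rightarrow> nat \<Rightarrow> bool" where
  "periodic_from D c T t0 \<longleftrightarrow>
     (\<forall>t\<ge>t0. \<forall>v\<in>pverts D. chips D c t v = chips D c (t + T) v)"

definition game_period :: "'a pair_pre_digraph \<Rightarrow> ('a \<Rightarrow> nat) \<Rightarrow> nat" where
  "game_period D c = (LEAST T. 0 < T \<and> (\<exists>t0. periodic_from D c T t0))"

definition periodic_start :: "'a pair_pre_digraph \<Rightarrow> ('a \<Rightarrow> nat) \<Rightarrow> nat" where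
  "periodic_start D c = (LEAST t0. periodic_from D c (game_period D c) t0)"

(* The shift by periodic_start is the relabelling of that round as round 0. *)
definition firing_bit :: "'a pair_pre_digraph \<Rightarrow> ('a \<Rightarrow> nat) \<Rightarrow> nat \<Rightarrow> 'a \<Rightarrow> nat" where
  "firing_bit D c t v =
     (if fires D (chips D c (periodic_start D c + t)) v then 1 else 0)"

definition atomic_firing_sequence ::
    "'a pair_pre_digraph \<Rightarrow> ('a \<Rightarrow> nat) \<Rightarrow> 'a \<Rightarrow> nat list" where
  "atomic_firing_sequence D c v = map (\<lambda>t. firing_bit D c t v) [0..<game_period D c]"

(* The remaining facts show that the two LEAST operators above are well defined on
   every finite digraph: the number of chips is conserved, so some configuration recurs. *)

lemma out_degree_with_proj:
  assumes "pair_fin_digraph D"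
  shows "out_degree (with_proj D) u = card {v \<in> pverts D. (u, v) \<in> parcs D}"
proof -
  interpret pair_fin_digraph D by fact
  have "out_arcs (with_proj D) u = Pair u ` {v \<in> pverts D. (u, v) \<in> parcs D}"
    by (auto simp: out_arcs_def dest: in_arcsD2)
  then show ?thesis
    unfolding out_degree_def by (simp add: card_image inj_on_def)
qed

lemma chip_step_conserves:
  assumes "pair_fin_digraph D"
  shows "(\<Sum>v\<in>pverts D. chip_step D c v) = (\<Sum>v\<in>pverts D. c v)"
proof -
  interpret pair_fin_digraph D by fact
  let ?V = "pverts D"
  let ?d = "\<lambda>v. if fires D c v then out_degree (with_proj D) v else 0"
  let ?i = "\<lambda>v. card {u \<in> ?V. (u, v) \<in> parcs D \<and> fires D c u}"
  let ?e = "\<lambda>u v. if (u, v) \<in> parcs D \<and> fires D c u then 1 else 0 :: nat"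
  have fin: "finite ?V" by (rule pair_finite_verts)
  have "(\<Sum>v\<in>?V. ?i v) = (\<Sum>v\<in>?V. \<Sum>u\<in>?V. ?e u v)"
    using fin by (intro sum.cong refl) (simp add: sum.If_cases Int_def)
  also have "\<dots> = (\<Sum>u\<in>?V. \<Sum>v\<in>?V. ?e u v)"
    by (rule sum.swap)
  also have "\<dots> = (\<Sum>u\<in>?V. ?d u)"
    using fin
    by (intro sum.cong refl) (simp add: sum.If_cases Int_def out_degree_with_proj[OF assms])
  finally have swap: "(\<Sum>v\<in>?V. ?i v) = (\<Sum>u\<in>?V. ?d u)" .
  have "chip_step D c v + ?d v = c v + ?i v" for v
    by (auto simp: chip_step_def fires_def)
  then have "(\<Sum>v\<in>?V. chip_step D c v) + (\<Sum>v\<in>?V. ?d v) = (\<Sum>v\<in>?V. c v) + (\<Sum>v\<in>?V. ?i v)"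
    unfolding sum.distrib[symmetric] by simp
  with swap show ?thesis by simp
qed

lemma chip_step_cong:
  assumes "\<And>v. v \<in> pverts D \<Longrightarrow> c v = c' v" "v \<in> pverts D"
  shows "chip_step D c v = chip_step D c' v"
proof -
  have "fires D c u = fires D c' u" if "u \<in> pverts D" for u
    using assms(1)[OF that] by (simp add: fires_def)
  then have "{u \<in> pverts D. (u, v) \<in> parcs D \<and> fires D c u}
      = {u \<in> pverts D. (u, v) \<in> parcs D \<and> fires D c' u}"
    by blast
  then show ?thesis
    using assms by (simp add: chip_step_def fires_def)
qed

lemma period_exists:
  assumes "pair_fin_digraph D"
  shows "\<exists>T>0. \<exists>t0. periodic_from D c T t0"
proof -
  interpret pair_fin_digraph D by fact
  let ?V = "pverts D"
  define N where "N = (\<Sum>v\<in>?V. c v)"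
  define f where "f t = restrict (chips D c t) ?V" for t
  have total: "(\<Sum>v\<in>?V. chips D c t v) = N" for t
    by (induction t) (simp_all add: chips_def N_def chip_step_conserves[OF assms])
  have "chips D c t v \<le> N" if "v \<in> ?V" for t v
    using member_le_sum[of v ?V "chips D c t"] that pair_finite_verts total by simp
  then have "range f \<subseteq> ?V \<rightarrow>\<^sub>E {..N}"
    by (auto simp: f_def)
  then have "finite (range f)"
    by (rule finite_subset) (simp add: finite_PiE pair_finite_verts)
  then have "\<not> inj f"
    using finite_imageD infinite_UNIV_nat by blast
  then obtain i j where "i < j" "f i = f j"
    by (metis injI linorder_neqE_nat)
  have eq: "chips D c i v = chips D c j v" if "v \<in> ?V" for v
    using fun_cong[OF \<open>f i = f j\<close>, of v] that by (simp add: f_def)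
  have "\<forall>v\<in>?V. chips D c (i + k) v = chips D c (j + k) v" for k
  proof (induction k)
    case (Suc k)
    then show ?case
      using chip_step_cong[of D "chips D c (i + k)" "chips D c (j + k)"]
      by (simp add: chips_def)
  qed (simp add: eq)
  note shift = this
  have "periodic_from D c (j - i) i"
    unfolding periodic_from_def
  proof (intro allI impI)
    fix t assume "i \<le> t"
    with \<open>i < j\<close> have "i + (t - i) = t" "j + (t - i) = t + (j - i)"
      by auto
    with shift[of "t - i"] show "\<forall>v\<in>?V. chips D c t v = chips D c (t + (j - i)) v"
      by simp
  qed
  with \<open>i < j\<close> show ?thesis
    by (intro exI[of _ "j - i"]) auto
qed

lemma game_period_pos:
  assumes "pair_fin_digraph D"
  shows "0 < game_period D c"
  using LeastI_ex[OF period_exists[OF assms, of c]]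
  by (simp add: game_period_def)

lemma periodic_start:
  assumes "pair_fin_digraph D"
  shows "periodic_from D c (game_period D c) (periodic_start D c)"
proof -
  have "\<exists>t0. periodic_from D c (game_period D c) t0"
    using LeastI_ex[OF period_exists[OF assms, of c]]
    by (simp add: game_period_def)
  then show ?thesis
    unfolding periodic_start_def by (rule LeastI_ex)
qed

end

theory Submission
  imports Defs
begin

text \<open>A vertex that does not fire during a period cannot receive a chip in it, since it could never
  get rid of it. So its in-neighbours do not fire either, and by strong connectivity no vertex does.
  The configuration is then constant and the period is 1.\<close>

lemma chips_Suc: "chips D c (Suc t) = chip_step D (chips D c t)"
  by (simp add: chips_def)

lemma chip_step_not_fires:
  assumes "\<not> fires D c v"
  shows "chip_step D c v = c v + card {u \<in> pverts D. (u, v) \<in> parcs D \<and> fires D c u}"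
  using assms by (simp add: chip_step_def)

text \<open>While \<open>w\<close> is silent its chip count is nondecreasing, and a firing
  in-neighbour makes it strictly larger. A strict rise cannot be undone by round
  \<open>t0 + T\<close>, contradicting \<open>recurs\<close>.\<close>

lemma in_neighbour_not_fires:
  assumes "pair_fin_digraph D"
    and "(u, w) \<in> parcs D"
    and recurs: "chips D c (t0 + T) w = chips D c t0 w"
    and silent: "\<And>k. k < T \<Longrightarrow> \<not> fires D (chips D c (t0 + k)) w"
    and "k < T"
  shows "\<not> fires D (chips D c (t0 + k)) u"
proof
  assume "fires D (chips D c (t0 + k)) u"
  interpret pair_fin_digraph D by fact
  let ?I = "{u \<in> pverts D. (u, w) \<in> parcs D \<and> fires D (chips D c (t0 + k)) u}"
  have step: "chips D c (t0 + j) w \<le> chips D c (t0 + Suc j) w" if "j < T" for j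
    using chip_step_not_fires[OF silent[OF that]] by (simp add: chips_Suc)
  have mono: "chips D c (t0 + i) w \<le> chips D c (t0 + j) w" if "i \<le> j" "j \<le> T" for i j
    using that
  proof (induction j rule: dec_induct)
    case (step n)
    then show ?case
      using \<open>\<And>j. j < T \<Longrightarrow> chips D c (t0 + j) w \<le> chips D c (t0 + Suc j) w\<close>[of n] by simp
  qed simp
  have "u \<in> ?I"
    using \<open>fires D (chips D c (t0 + k)) u\<close> assms(2) in_arcsD1[of u w] by simp
  moreover have "finite ?I"
    by (simp add: pair_finite_verts)
  ultimately have "0 < card ?I"
    using card_gt_0_iff by blast
  then have "chips D c (t0 + k) w < chips D c (t0 + Suc k) w"
    using chip_step_not_fires[OF silent[OF \<open>k < T\<close>]] by (simp add: chips_Suc)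
  \<comment> \<open>Monotonicity before and after round \<open>t0 + k\<close> surrounds the strict
    rise, so \<open>w\<close> would hold more chips in round \<open>t0 + T\<close> than in round
    \<open>t0\<close>.\<close>
  with mono[of 0 k] mono[of "Suc k" T] recurs \<open>k < T\<close> show False
    by simp
qed

lemma game_period_eq_1_if_silent:
  assumes "\<And>u. u \<in> pverts D \<Longrightarrow> \<not> fires D (chips D c t0) u"
    and "0 < game_period D c"
  shows "game_period D c = 1"
proof -
  \<comment> \<open>The set of firing in-neighbours is empty; \<open>conj_cong\<close> supplies
    membership in \<open>pverts D\<close> when the firing conjunct is simplified.\<close>
  have fixed: "chip_step D (chips D c t0) u = chips D c t0 u" if "u \<in> pverts D" for u
    using chip_step_not_fires[OF assms(1)[OF that]] assms(1) by (simp cong: conj_cong)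
  have const: "\<forall>u\<in>pverts D. chips D c (t0 + k) u = chips D c t0 u" for k
  proof (induction k)
    case (Suc k)
    \<comment> \<open>The induction hypothesis gives agreement on \<open>pverts D\<close> only,
      hence \<open>chip_step_cong\<close> instead of rewriting with equal configurations.\<close>
    then show ?case
      using chip_step_cong[of D "chips D c (t0 + k)" "chips D c t0"] fixed
      by (simp add: chips_Suc)
  qed simp
  have "chips D c t u = chips D c (t + 1) u" if "t0 \<le> t" "u \<in> pverts D" for t u
    using const[of "t - t0"] const[of "Suc (t - t0)"] that by simp
  then have "periodic_from D c 1 t0"
    unfolding periodic_from_def by blast
  then have "game_period D c \<le> 1"
    unfolding game_period_def by (intro Least_le) auto
  with assms(2) show ?thesis
    by simp
qed

theorem lemma4p1:
  fixes D :: "'a pair_pre_digraph" and c :: "'a \<Rightarrow> nat" and v :: 'a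
    and s :: "nat list" and l :: nat
  assumes "length s = l" and "l \<ge> 2" and "\<forall>x\<in>set s. x = 0"
    and "pair_fin_digraph D" and "strongly_connected (with_proj D)"
    and "v \<in> pverts D"
  shows "atomic_firing_sequence D c v \<noteq> s"
proof
  assume s: "atomic_firing_sequence D c v = s"
  interpret pair_fin_digraph D by fact
  define T where "T = game_period D c"
  define t0 where "t0 = periodic_start D c"
  have "T \<ge> 2"
    using s assms(1,2) by (auto simp: atomic_firing_sequence_def T_def)
  have recurs: "chips D c (t0 + T) w = chips D c t0 w" if "w \<in> pverts D" for w
    using periodic_start[OF assms(4), of c] that
    unfolding periodic_from_def T_def t0_def by (metis order_refl)
  have v_silent: "\<not> fires D (chips D c (t0 + k)) v" if "k < T" for k
  proof -
    have "firing_bit D c k v \<in> set s"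
      using that by (auto simp: s[symmetric] atomic_firing_sequence_def T_def)
    with assms(3) show ?thesis
      by (auto simp: firing_bit_def t0_def split: if_splits)
  qed
  have "\<not> fires D (chips D c (t0 + k)) u" if "u \<in> pverts D" "k < T" for u k
  proof -
    have "u \<rightarrow>\<^sup>*\<^bsub>with_proj D\<^esub> v"
      using assms(5,6) that(1) by (auto simp: strongly_connected_def)
    \<comment> \<open>Induction backwards along a path to \<open>v\<close>. The claim covers all
      rounds of the period at once, since silencing an in-neighbour in one round uses the silence of
      its successor throughout the period.\<close>
    then have "\<forall>k<T. \<not> fires D (chips D c (t0 + k)) u"
    proof (induction rule: converse_reachable_induct)
      case base
      then show ?case using v_silent by simp
    next
      case (step x y)
      then have "(x, y) \<in> parcs D" by simp
      then show ?case
        using in_neighbour_not_fires[OF assms(4) _ recurs, of x y] step.IH in_arcsD2 by blast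
    qed
    with that(2) show ?thesis by simp
  qed
  \<comment> \<open>One round in which no vertex fires is enough to freeze the game; round
    \<open>t0\<close> is taken.\<close>
  from this[of _ 0] \<open>T \<ge> 2\<close> have "T = 1"
    using game_period_eq_1_if_silent[of D c t0] game_period_pos[OF assms(4), of c]
    by (simp add: T_def)
  with \<open>T \<ge> 2\<close> show False
    by simp
qed

end
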